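(* In the probabilistic call-by-value calculus $(\mathcal M(\Lambda_\oplus),\{\Rrightarrow_{\beta_v},\Rrightarrow_\oplus\})$, let $\Rrightarrow_{\mathsf w}:=\Rrightarrow_{\mathsf w\beta_v}\cup\Rrightarrow_\oplus$ and $\Rrightarrow_{\neg\mathsf w}:=\Rrightarrow_{\neg\mathsf w\beta_v}$. Then weak factorization holds: $(\Rrightarrow_{\beta_v}\cup\Rrightarrow_\oplus)^*\subseteq\Rrightarrow_{\mathsf w}^*\cdot\Rrightarrow_{\neg\mathsf w}^*$.
   Context: Terms: $M::=x\mid\lambda x.M\mid MM\mid M\oplus M$ (modulo $\alpha$-equivalence); values $V::=x\mid\lambda x.M$. Contexts $C::=\langle\cdot\rangle\mid CM\mid MC\mid\lambda x.C\mid C\oplus M\mid M\oplus C$; weak contexts $S::=\langle\cdot\rangle\mid SM\mid MS$. A multi-distribution is a finite multiset $[p_iM_i\mid i\in I]$ of pairs with $p_i\in(0,1]$, $M_i$ terms, $\sum_ip_i\le1$; $\mathcal M(\Lambda_\oplus)$ is the set of multi-distributions, $+$ is multiset sum, $q\cdot[p_iM_i]_{i}:=[(qp_i)M_i]_i$, and $[M]$ means $[1M]$. Term-to-multi-distribution steps: $C\langle(\lambda x.M)V\rangle\to_{\beta_v}[C\langle M\{x:=V\}\rangle]$ for any context $C$; $S\langle M\oplus N\rangle\to_\oplus[\tfrac12 S\langle M\rangle,\tfrac12 S\langle N\rangle]$ for weak contexts $S$ only. $\to_{\mathsf w\beta_v}$ is the restriction of $\to_{\beta_v}$ to weak contexts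 $C$, and $\to_{\neg\mathsf w\beta_v}$ its restriction to contexts $C$ that are not weak. Lifting of a relation $\to_r\subseteq\Lambda_\oplus\times\mathcal M(\Lambda_\oplus)$ to $\Rrightarrow_r\subseteq\mathcal M(\Lambda_\oplus)\times\mathcal M(\Lambda_\oplus)$ is inductively defined by: $[M]\Rrightarrow_r[M]$; $[M]\Rrightarrow_r\mathtt m$ if $M\to_r\mathtt m$; and $[p_iM_i\mid i\in I]\Rrightarrow_r\sum_{i\in I}p_i\cdot\mathtt m_i$ if $[M_i]\Rrightarrow_r\mathtt m_i$ for each $i\in I$. $\Rrightarrow_{\beta_v},\Rrightarrow_\oplus,\Rrightarrow_{\mathsf w\beta_v},\Rrightarrow_{\neg\mathsf w\beta_v}$ are the liftings of $\to_{\beta_v},\to_\oplus,\to_{\mathsf w\beta_v},\to_{\neg\mathsf w\beta_v}$. $^*$ is reflexive-transitive closure, $\cdot$ composition. *)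

theory Defs
  imports Complex_Main "HOL-Library.Multiset"
begin

text \<open>Terms modulo \<open>\<alpha>\<close>-equivalence are represented by de Bruijn indices.\<close>

datatype trm =
    Var nat
  | Lam trm
  | App trm trm
  | Choice trm trm

fun is_value :: "trm \<Rightarrow> bool" where
  "is_value (Var _) = True"
| "is_value (Lam _) = True"
| "is_value (App _ _) = False"
| "is_value (Choice _ _) = False"

primrec shift :: "nat \<Rightarrow> trm \<Rightarrow> trm" where
  "shift k (Var i) = (if i < k then Var i else Var (Suc i))"
| "shift k (Lam M) = Lam (shift (Suc k) M)"
| "shift k (App M N) = App (shift k M) (shift k N)"
| "shift k (Choice M N) = Choice (shift k M) (shift k N)"

text \<open>\<open>subst k N M\<close> replaces index \<open>k\<close> in \<open>M\<close> by \<open>N\<close> and lowers the indices above \<open>k\<close>, since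
  the binder of \<open>k\<close> disappears in a \<open>\<beta>\<close>-contraction.\<close>

primrec subst :: "nat \<Rightarrow> trm \<Rightarrow> trm \<Rightarrow> trm" where
  "subst k N (Var i) = (if i < k then Var i else if i = k then N else Var (i - 1))"
| "subst k N (Lam M) = Lam (subst (Suc k) (shift 0 N) M)"
| "subst k N (App M M') = App (subst k N M) (subst k N M')"
| "subst k N (Choice M M') = Choice (subst k N M) (subst k N M')"

datatype ctx =
    Hole
  | CAppL ctx trm
  | CAppR trm ctx
  | CLam ctx
  | CChoiceL ctx trm
  | CChoiceR trm ctx

text \<open>Filling the hole may capture variables of the plugged term, so no indices are shifted.\<close>

primrec plug :: "ctx \<Rightarrow> trm \<Rightarrow> trm" where
  "plug Hole M = M"
| "plug (CAppL C N) M = App (plug C M) N"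
| "plug (CAppR N C) M = App N (plug C M)"
| "plug (CLam C) M = Lam (plug C M)"
| "plug (CChoiceL C N) M = Choice (plug C M) N"
| "plug (CChoiceR N C) M = Choice N (plug C M)"

primrec weak :: "ctx \<Rightarrow> bool" where
  "weak Hole = True"
| "weak (CAppL C N) = weak C"
| "weak (CAppR N C) = weak C"
| "weak (CLam C) = False"
| "weak (CChoiceL C N) = False"
| "weak (CChoiceR N C) = False"

type_synonym mdist = "(real \<times> trm) multiset"

definition mdists :: "mdist set" where
  "mdists = {m. (\<forall>(p, M) \<in># m. 0 < p \<and> p \<le> 1) \<and> (\<Sum>(p, M) \<in># m. p) \<le> 1}"

definition scale :: "real \<Rightarrow> mdist \<Rightarrow> mdist" where
  "scale q m = image_mset (\<lambda>(p, M). (q * p, M)) m"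

definition beta_v_in :: "ctx set \<Rightarrow> (trm \<times> mdist) set" where
  "beta_v_in \<C> = {(plug C (App (Lam M) V), {#(1, plug C (subst 0 V M))#}) | C M V.
     C \<in> \<C> \<and> is_value V}"

definition beta_v :: "(trm \<times> mdist) set" where
  "beta_v = beta_v_in UNIV"

definition weak_beta_v :: "(trm \<times> mdist) set" where
  "weak_beta_v = beta_v_in {C. weak C}"

definition nonweak_beta_v :: "(trm \<times> mdist) set" where
  "nonweak_beta_v = beta_v_in {C. \<not> weak C}"

definition oplus :: "(trm \<times> mdist) set" where
  "oplus = {(plug S (Choice M N), {#(1/2, plug S M), (1/2, plug S N)#}) | S M N. weak S}"

text \<open>A finite index set of natural numbers suffices to enumerate any multi-distribution
  with its multiplicities, and is no restriction on the third rule.\<close>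

inductive_set lifting :: "(trm \<times> mdist) set \<Rightarrow> (mdist \<times> mdist) set"
  for r :: "(trm \<times> mdist) set" where
  refl: "({#(1, M)#}, {#(1, M)#}) \<in> lifting r"
| step: "(M, m) \<in> r \<Longrightarrow> ({#(1, M)#}, m) \<in> lifting r"
| sum: "\<lbrakk>finite (I :: nat set);
         {#(p i, M i). i \<in># mset_set I#} \<in> mdists;
         \<And>i. i \<in> I \<Longrightarrow> ({#(1, M i)#}, m i) \<in> lifting r\<rbrakk>
    \<Longrightarrow> ({#(p i, M i). i \<in># mset_set I#}, (\<Sum>i\<in>I. scale (p i) (m i))) \<in> lifting r"

definition weak_red :: "(mdist \<times> mdist) set" where
  "weak_red = lifting weak_beta_v \<union> lifting oplus"

definition nonweak_red :: "(mdist \<times> mdist) set" where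
  "nonweak_red = lifting nonweak_beta_v"

text \<open>The lifted relations live on multi-distributions, although \<^typ>\<open>mdist\<close> does not enforce
  the side conditions on the weights.\<close>

lemma mdists_empty: "{#} \<in> mdists"
  by (simp add: mdists_def)

lemma mdists_single: "{#(1, M)#} \<in> mdists"
  by (simp add: mdists_def)

lemma step_mdists:
  "beta_v_in \<C> \<subseteq> UNIV \<times> mdists" "oplus \<subseteq> UNIV \<times> mdists"
  by (auto simp: beta_v_in_def oplus_def mdists_def)

lemma weight_scale: "(\<Sum>(p, M) \<in># scale q m. p) = q * (\<Sum>(p, M) \<in># m. p)"
  by (induction m) (auto simp: scale_def algebra_simps)

lemma weight_sum:
  "finite I \<Longrightarrow> (\<Sum>(p, M) \<in># (\<Sum>i\<in>I. f i). p) = (\<Sum>i\<in>I. \<Sum>(p, M) \<in># f i. p)"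
  by (induction I rule: finite_induct) auto

lemma lifting_mdists:
  assumes "r \<subseteq> UNIV \<times> mdists"
  shows "lifting r \<subseteq> mdists \<times> mdists"
proof -
  have "m \<in> mdists \<and> n \<in> mdists" if "(m, n) \<in> lifting r" for m n
    using that
  proof (induction rule: lifting.induct)
    case (refl M)
    then show ?case by (simp add: mdists_single)
  next
    case (step M m)
    then show ?case using assms by (auto simp: mdists_single)
  next
    case (sum I p M m)
    have p: "0 < p i" "p i \<le> 1" if "i \<in> I" for i
      using sum.hyps that by (auto simp: mdists_def)
    have tot: "(\<Sum>i\<in>I. p i) \<le> 1"
      using sum.hyps by (simp add: mdists_def sum_unfold_sum_mset multiset.map_comp comp_def)
    have m: "m i \<in> mdists" if "i \<in> I" for i
      using sum.IH that by blast
    have "(\<Sum>i\<in>I. \<Sum>(q, N) \<in># scale (p i) (m i). q) \<le> (\<Sum>i\<in>I. p i)"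
      using p m by (intro sum_mono) (auto simp: weight_scale mdists_def less_imp_le mult_left_le)
    then have "(\<Sum>(q, N) \<in># (\<Sum>i\<in>I. scale (p i) (m i)). q) \<le> 1"
      using tot sum.hyps(1) by (simp add: weight_sum)
    moreover have "0 < q \<and> q \<le> 1" if "(q, N) \<in># (\<Sum>i\<in>I. scale (p i) (m i))" for q N
    proof -
      from that sum.hyps(1) obtain i q' where i: "i \<in> I" "(q', N) \<in># m i" "q = p i * q'"
        by (auto simp: set_mset_sum scale_def)
      with m[of i] have "0 < q'" "q' \<le> 1" by (auto simp: mdists_def)
      with p[OF i(1)] i(3) show ?thesis by (simp add: mult_le_one)
    qed
    ultimately show ?case using sum.hyps by (auto simp: mdists_def)
  qed
  then show ?thesis by auto
qed

end

theory Submission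
  imports Defs
begin

text \<open>
  The proof is Takahashi style. Let \<open>par\<close> be parallel \<open>\<beta>\<^sub>v\<close>-reduction and \<open>ipar\<close> its internal
  part, which contracts only redexes in non-weak position. A parallel step factors as
  weak \<open>\<beta>\<^sub>v\<close>-steps followed by one \<open>ipar\<close> step, because substituting a value preserves both kinds
  of step. If \<open>P\<close> is an \<open>ipar\<close>-reduct of \<open>M\<close>, then \<open>M\<close> already has every weak redex of \<open>P\<close>;
  contracting it in \<open>M\<close> leaves terms that reduce to the contracta in \<open>P\<close> by a single parallel
  step, which is again factored. So one pointwise \<open>ipar\<close> step followed by a weak step can be
  replaced by weak steps followed by one pointwise \<open>ipar\<close> step, and factorization follows by
  induction on the length of the reduction.
\<close>

section \<open>Shifting and substitution\<close>

lemma is_value_shift [simp]: "is_value (shift k M) = is_value M"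
  by (cases M) auto

lemma is_value_subst: "is_value V \<Longrightarrow> is_value M \<Longrightarrow> is_value (subst k V M)"
  by (cases M) auto

lemma shift_shift: "i \<le> k \<Longrightarrow> shift (Suc k) (shift i M) = shift i (shift k M)"
  by (induction M arbitrary: i k) auto

lemma subst_shift_cancel [simp]: "subst k N (shift k M) = M"
  by (induction M arbitrary: k N) auto

lemma shift_subst_le:
  "j \<le> k \<Longrightarrow> shift k (subst j N M) = subst j (shift k N) (shift (Suc k) M)"
  by (induction M arbitrary: j k N) (auto simp: shift_shift)

lemma shift_subst_ge:
  "k \<le> j \<Longrightarrow> shift k (subst j N M) = subst (Suc j) (shift k N) (shift k M)"
  by (induction M arbitrary: j k N) (auto simp: shift_shift)

text \<open>The substitution lemma in de Bruijn form: inside the binder of \<open>i\<close>, index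
  \<open>k\<close> becomes \<open>Suc k\<close> and \<open>V\<close> is shifted. For
  \<open>i = 0\<close> it says that substitution commutes with contraction.\<close>

lemma subst_subst:
  "i \<le> k \<Longrightarrow> subst k V (subst i W M) = subst i (subst k V W) (subst (Suc k) (shift i V) M)"
  by (induction M arbitrary: i k V W) (auto simp: shift_shift shift_subst_ge)

lemma rtrancl_map:
  assumes "\<And>x y. (x, y) \<in> r \<Longrightarrow> (f x, f y) \<in> s" "(x, y) \<in> r\<^sup>*"
  shows "(f x, f y) \<in> s\<^sup>*"
  using assms(2) by induction (auto intro: assms(1) rtrancl_into_rtrancl)

section \<open>Reduction of terms in a class of contexts\<close>

text \<open>A \<beta>-step yields a single term of weight 1, so \<open>beta_v_in\<close> can be
  studied on terms alone.\<close>

definition cbeta :: "ctx set \<Rightarrow> (trm \<times> trm) set" where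
  "cbeta \<C> = {(plug C (App (Lam M) V), plug C (subst 0 V M)) | C M V. C \<in> \<C> \<and> is_value V}"

lemma beta_v_in_iff: "(M, m) \<in> beta_v_in \<C> \<longleftrightarrow> (\<exists>N. m = {#(1, N)#} \<and> (M, N) \<in> cbeta \<C>)"
  by (auto simp: beta_v_in_def cbeta_def)

lemma cbetaI:
  "C \<in> \<C> \<Longrightarrow> is_value V \<Longrightarrow> (plug C (App (Lam M) V), plug C (subst 0 V M)) \<in> cbeta \<C>"
  by (auto simp: cbeta_def)

text \<open>\<open>F\<close> adds one frame around a context. Two context classes are needed because
  a frame below \<open>Lam\<close> or \<open>Choice\<close> turns arbitrary contexts into non-weak
  ones.\<close>

lemma cbeta_map:
  assumes "\<And>C. C \<in> \<C> \<Longrightarrow> F C \<in> \<D>" "\<And>C M. plug (F C) M = f (plug C M)" "(M, N) \<in> cbeta \<C>"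
  shows "(f M, f N) \<in> cbeta \<D>"
proof -
  obtain C Q V where "C \<in> \<C>" "is_value V" "M = plug C (App (Lam Q) V)" "N = plug C (subst 0 V Q)"
    using assms(3) by (auto simp: cbeta_def)
  then show ?thesis using cbetaI[of "F C" \<D> V Q] assms(1,2) by simp
qed

lemma cbeta_rtrancl_map:
  assumes "\<And>C. C \<in> \<C> \<Longrightarrow> F C \<in> \<D>" "\<And>C M. plug (F C) M = f (plug C M)" "(M, N) \<in> (cbeta \<C>)\<^sup>*"
  shows "(f M, f N) \<in> (cbeta \<D>)\<^sup>*"
  using assms(3) by (rule rtrancl_map[rotated]) (rule cbeta_map[where F = F, OF assms(1,2)])

lemma cbeta_App:
  assumes "\<And>C N. C \<in> \<C> \<Longrightarrow> CAppL C N \<in> \<C> \<and> CAppR N C \<in> \<C>"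
    and "(M, M') \<in> (cbeta \<C>)\<^sup>*" "(N, N') \<in> (cbeta \<C>)\<^sup>*"
  shows "(App M N, App M' N') \<in> (cbeta \<C>)\<^sup>*"
proof -
  have "(App M N, App M' N) \<in> (cbeta \<C>)\<^sup>*"
    by (rule cbeta_rtrancl_map[where F = "\<lambda>C. CAppL C N" and f = "\<lambda>M. App M N", OF _ _ assms(2)])
       (auto simp: assms(1))
  also have "(App M' N, App M' N') \<in> (cbeta \<C>)\<^sup>*"
    by (rule cbeta_rtrancl_map[where F = "CAppR M'" and f = "App M'", OF _ _ assms(3)])
       (auto simp: assms(1))
  finally show ?thesis .
qed

abbreviation "wbeta \<equiv> cbeta {C. weak C}"
abbreviation "ibeta \<equiv> cbeta {C. \<not> weak C}"
abbreviation "fbeta \<equiv> cbeta UNIV"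

lemma wbeta_AppL: "(M, M') \<in> wbeta \<Longrightarrow> (App M N, App M' N) \<in> wbeta"
  by (rule cbeta_map[where F = "\<lambda>C. CAppL C N" and f = "\<lambda>M. App M N"]) auto

lemma wbeta_AppR: "(M, M') \<in> wbeta \<Longrightarrow> (App N M, App N M') \<in> wbeta"
  by (rule cbeta_map[where F = "CAppR N" and f = "App N"]) auto

lemma wbeta_App:
  "(M, M') \<in> wbeta\<^sup>* \<Longrightarrow> (N, N') \<in> wbeta\<^sup>* \<Longrightarrow> (App M N, App M' N') \<in> wbeta\<^sup>*"
  by (rule cbeta_App) auto

text \<open>The hole of a weak context lies under no binder, so \<open>k\<close> and
  \<open>W\<close> stay unchanged down to the redex. It remains a redex because values are closed
  under substitution of values.\<close>

lemma wbeta_subst: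
  assumes "(M, N) \<in> wbeta" "is_value W"
  shows "(subst k W M, subst k W N) \<in> wbeta"
proof -
  obtain C Q V where *: "weak C" "is_value V" "M = plug C (App (Lam Q) V)" "N = plug C (subst 0 V Q)"
    using assms(1) by (auto simp: cbeta_def)
  have "(subst k W (plug C (App (Lam Q) V)), subst k W (plug C (subst 0 V Q))) \<in> wbeta"
    using *(1)
  proof (induction C)
    case Hole
    have "(App (Lam (subst (Suc k) (shift 0 W) Q)) (subst k W V),
        subst 0 (subst k W V) (subst (Suc k) (shift 0 W) Q)) \<in> wbeta"
      using cbetaI[of Hole] *(2) assms(2) by (simp add: is_value_subst)
    then show ?case by (simp add: subst_subst)
  qed (auto intro: wbeta_AppL wbeta_AppR)
  with * show ?thesis by simp
qed

section \<open>Parallel reduction\<close>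

inductive par :: "trm \<Rightarrow> trm \<Rightarrow> bool" where
  par_Var: "par (Var i) (Var i)"
| par_Lam: "par M M' \<Longrightarrow> par (Lam M) (Lam M')"
| par_App: "par M M' \<Longrightarrow> par N N' \<Longrightarrow> par (App M N) (App M' N')"
| par_Choice: "par M M' \<Longrightarrow> par N N' \<Longrightarrow> par (Choice M N) (Choice M' N')"
| par_beta: "par M M' \<Longrightarrow> par V V' \<Longrightarrow> is_value V \<Longrightarrow> par (App (Lam M) V) (subst 0 V' M')"

text \<open>Below \<open>Lam\<close> and \<open>Choice\<close> every position is non-weak, so the
  premises are full \<open>par\<close>. The two sides of an application are weak positions, so there
  the premises stay internal.\<close>

inductive ipar :: "trm \<Rightarrow> trm \<Rightarrow> bool" where
  ipar_Var: "ipar (Var i) (Var i)"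
| ipar_Lam: "par M M' \<Longrightarrow> ipar (Lam M) (Lam M')"
| ipar_App: "ipar M M' \<Longrightarrow> ipar N N' \<Longrightarrow> ipar (App M N) (App M' N')"
| ipar_Choice: "par M M' \<Longrightarrow> par N N' \<Longrightarrow> ipar (Choice M N) (Choice M' N')"

inductive_cases ipar_LamE: "ipar M (Lam N)"
inductive_cases ipar_AppE: "ipar M (App N P)"
inductive_cases ipar_ChoiceE: "ipar M (Choice N P)"

lemma par_refl: "par M M"
  by (induction M) (auto intro: par.intros)

lemma ipar_refl: "ipar M M"
  by (induction M) (auto intro: ipar.intros par_refl)

lemma ipar_imp_par: "ipar M N \<Longrightarrow> par M N"
  by (induction rule: ipar.induct) (auto intro: par.intros)

lemma par_value_imp_ipar: "par V W \<Longrightarrow> is_value V \<Longrightarrow> ipar V W"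
  by (cases rule: par.cases) (auto intro: ipar.intros)

lemma is_value_par: "par V W \<Longrightarrow> is_value V \<Longrightarrow> is_value W"
  by (cases rule: par.cases) auto

text \<open>Internal steps keep the root constructor. The backward direction matters: an argument
  that is a value after the step was one before it.\<close>

lemma ipar_is_value_iff: "ipar V W \<Longrightarrow> is_value V \<longleftrightarrow> is_value W"
  by (cases rule: ipar.cases) auto

lemma par_shift: "par M N \<Longrightarrow> par (shift k M) (shift k N)"
proof (induction arbitrary: k rule: par.induct)
  case (par_beta M M' V V')
  then show ?case by (auto simp: shift_subst_le intro: par.par_beta)
qed (auto intro: par.intros)

lemma par_subst:
  "par M M' \<Longrightarrow> par V V' \<Longrightarrow> is_value V \<Longrightarrow> par (subst k V M) (subst k V' M')"
proof (induction arbitrary: k V V' rule: par.induct)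
  case (par_beta M M' W W')
  then show ?case by (auto simp: subst_subst par_shift is_value_subst intro: par.par_beta)
qed (simp_all add: par.intros par_shift)

lemma ipar_subst:
  "ipar M M' \<Longrightarrow> ipar V V' \<Longrightarrow> is_value V \<Longrightarrow> ipar (subst k V M) (subst k V' M')"
  by (induction arbitrary: k rule: ipar.induct)
     (simp_all add: ipar.intros par_subst par_shift ipar_imp_par)

section \<open>Moving weak steps before internal parallel steps\<close>

lemma par_factor: "par M N \<Longrightarrow> \<exists>P. (M, P) \<in> wbeta\<^sup>* \<and> ipar P N"
proof (induction rule: par.induct)
  case (par_App M M' N N')
  then show ?case by (meson ipar_App wbeta_App)
next
  case (par_beta M M' V V')
  then obtain P where P: "(M, P) \<in> wbeta\<^sup>*" "ipar P M'" by blast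
  have "(App (Lam M) V, subst 0 V M) \<in> wbeta"
    using cbetaI[of Hole] par_beta.hyps by simp
  \<comment> \<open>\<open>V\<close> is kept unreduced here: all its redexes lie under an
    abstraction, so its whole reduction belongs to the internal step.\<close>
  also have "(subst 0 V M, subst 0 V P) \<in> wbeta\<^sup>*"
    using P(1) par_beta.hyps by (intro rtrancl_map[where f = "subst 0 V", OF wbeta_subst]) auto
  finally show ?case
    using ipar_subst[OF P(2) par_value_imp_ipar[OF par_beta.hyps(2)]] par_beta.hyps by auto
qed (blast intro: ipar.intros)+

lemma ipar_wbeta_postpone:
  assumes "ipar M P" "(P, N) \<in> wbeta"
  shows "\<exists>Q. (M, Q) \<in> wbeta\<^sup>* \<and> ipar Q N"
proof -
  obtain C R V where *: "weak C" "is_value V" "P = plug C (App (Lam R) V)" "N = plug C (subst 0 V R)"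
    using assms(2) by (auto simp: cbeta_def)
  have "\<exists>Q. (M, Q) \<in> wbeta\<^sup>* \<and> ipar Q (plug C (subst 0 V R))"
    if "ipar M (plug C (App (Lam R) V))" using that *(1)
  proof (induction C arbitrary: M)
    case Hole
    \<comment> \<open>Since \<open>ipar\<close> keeps the root constructor, the redex in the reduct
      comes from a redex in \<open>M\<close>. The body is related only by \<open>par\<close>, being
      under \<open>Lam\<close>.\<close>
    then obtain R' V' where M: "M = App (Lam R') V'" and R': "par R' R" and V': "ipar V' V"
      by (auto elim!: ipar_AppE ipar_LamE)
    have v: "is_value V'" using V' *(2) by (simp add: ipar_is_value_iff)
    have step: "(M, subst 0 V' R') \<in> wbeta"
      using cbetaI[of Hole] v by (simp add: M)
    \<comment> \<open>Contraction brings redexes of the body into weak position, so the remaining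
      step is no longer internal and has to be factored anew.\<close>
    have "par (subst 0 V' R') (subst 0 V R)"
      using R' V' v by (simp add: par_subst ipar_imp_par)
    then obtain Q where "(subst 0 V' R', Q) \<in> wbeta\<^sup>*" "ipar Q (subst 0 V R)"
      using par_factor by blast
    with step show ?case by (auto intro: converse_rtrancl_into_rtrancl)
  next
    case (CAppL C N)
    then obtain M\<^sub>1 N\<^sub>1 where M: "M = App M\<^sub>1 N\<^sub>1" "ipar M\<^sub>1 (plug C (App (Lam R) V))" "ipar N\<^sub>1 N"
      by (auto elim!: ipar_AppE)
    with CAppL obtain Q where "(M\<^sub>1, Q) \<in> wbeta\<^sup>*" "ipar Q (plug C (subst 0 V R))" by fastforce
    with M show ?case by (intro exI[of _ "App Q N\<^sub>1"]) (auto intro: ipar_App wbeta_App)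
  next
    case (CAppR N C)
    then obtain M\<^sub>1 N\<^sub>1 where M: "M = App N\<^sub>1 M\<^sub>1" "ipar M\<^sub>1 (plug C (App (Lam R) V))" "ipar N\<^sub>1 N"
      by (auto elim!: ipar_AppE)
    with CAppR obtain Q where "(M\<^sub>1, Q) \<in> wbeta\<^sup>*" "ipar Q (plug C (subst 0 V R))" by fastforce
    with M show ?case by (intro exI[of _ "App N\<^sub>1 Q"]) (auto intro: ipar_App wbeta_App)
  qed auto
  with assms(1) * show ?thesis by simp
qed

text \<open>\<open>T\<close> is the counterpart of \<open>S\<close> in \<open>M\<close>. The
  branches of a choice are related by \<open>par\<close> only; once selected they stand in weak
  position, and each is factored separately, with weak steps of its own.\<close>

lemma ipar_oplus_postpone:
  assumes "ipar M (plug S (Choice A B))" "weak S"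
  shows "\<exists>T A\<^sub>0 B\<^sub>0 A\<^sub>1 B\<^sub>1. weak T \<and> M = plug T (Choice A\<^sub>0 B\<^sub>0) \<and>
    (plug T A\<^sub>0, A\<^sub>1) \<in> wbeta\<^sup>* \<and> ipar A\<^sub>1 (plug S A) \<and>
    (plug T B\<^sub>0, B\<^sub>1) \<in> wbeta\<^sup>* \<and> ipar B\<^sub>1 (plug S B)"
  using assms
proof (induction S arbitrary: M)
  case Hole
  then obtain A\<^sub>0 B\<^sub>0 where "M = Choice A\<^sub>0 B\<^sub>0" "par A\<^sub>0 A" "par B\<^sub>0 B"
    by (auto elim!: ipar_ChoiceE)
  then show ?case
    using par_factor[of A\<^sub>0 A] par_factor[of B\<^sub>0 B] by (intro exI[of _ Hole]) auto
next
  case (CAppL S N)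
  then obtain M\<^sub>1 N\<^sub>1 where M: "M = App M\<^sub>1 N\<^sub>1" "ipar M\<^sub>1 (plug S (Choice A B))" "ipar N\<^sub>1 N"
    by (auto elim!: ipar_AppE)
  with CAppL obtain T A\<^sub>0 B\<^sub>0 A\<^sub>1 B\<^sub>1 where "weak T" "M\<^sub>1 = plug T (Choice A\<^sub>0 B\<^sub>0)"
    "(plug T A\<^sub>0, A\<^sub>1) \<in> wbeta\<^sup>*" "ipar A\<^sub>1 (plug S A)"
    "(plug T B\<^sub>0, B\<^sub>1) \<in> wbeta\<^sup>*" "ipar B\<^sub>1 (plug S B)"
    by fastforce
  with M show ?case
    by (intro exI[of _ "CAppL T N\<^sub>1"] exI[of _ A\<^sub>0] exI[of _ B\<^sub>0]
        exI[of _ "App A\<^sub>1 N\<^sub>1"] exI[of _ "App B\<^sub>1 N\<^sub>1"])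
       (auto intro: ipar_App wbeta_App)
next
  case (CAppR N S)
  then obtain M\<^sub>1 N\<^sub>1 where M: "M = App N\<^sub>1 M\<^sub>1" "ipar M\<^sub>1 (plug S (Choice A B))" "ipar N\<^sub>1 N"
    by (auto elim!: ipar_AppE)
  with CAppR obtain T A\<^sub>0 B\<^sub>0 A\<^sub>1 B\<^sub>1 where "weak T" "M\<^sub>1 = plug T (Choice A\<^sub>0 B\<^sub>0)"
    "(plug T A\<^sub>0, A\<^sub>1) \<in> wbeta\<^sup>*" "ipar A\<^sub>1 (plug S A)"
    "(plug T B\<^sub>0, B\<^sub>1) \<in> wbeta\<^sup>*" "ipar B\<^sub>1 (plug S B)"
    by fastforce
  with M show ?case
    by (intro exI[of _ "CAppR N\<^sub>1 T"] exI[of _ A\<^sub>0] exI[of _ B\<^sub>0]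
        exI[of _ "App N\<^sub>1 A\<^sub>1"] exI[of _ "App N\<^sub>1 B\<^sub>1"])
       (auto intro: ipar_App wbeta_App)
qed auto

section \<open>Parallel steps compared with sequences of single steps\<close>

lemma fbeta_imp_par:
  assumes "(M, N) \<in> fbeta"
  shows "par M N"
proof -
  have "par (plug C (App (Lam Q) V)) (plug C (subst 0 V Q))" if "is_value V" for C Q V
    using that by (induction C) (auto intro: par.intros par_refl)
  with assms show ?thesis by (auto simp: cbeta_def)
qed

lemma ibeta_imp_ipar:
  assumes "(M, N) \<in> ibeta"
  shows "ipar M N"
proof -
  have "ipar (plug C (App (Lam Q) V)) (plug C (subst 0 V Q))"
    if "is_value V" "\<not> weak C" for C Q V
    using that(2)
    by (induction C)
       (auto intro!: ipar.intros par_refl ipar_refl fbeta_imp_par cbetaI simp: that(1))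
  with assms show ?thesis by (auto simp: cbeta_def)
qed

text \<open>Every context through \<open>Choice\<close> is non-weak, so unrestricted reductions of
  the branches suffice. The closure assumption holds for all contexts and for the non-weak ones,
  which serves both \<open>par\<close> and \<open>ipar\<close>.\<close>

lemma cbeta_Choice:
  assumes "\<And>C N. CChoiceL C N \<in> \<C> \<and> CChoiceR N C \<in> \<C>"
    and "(M, M') \<in> fbeta\<^sup>*" "(N, N') \<in> fbeta\<^sup>*"
  shows "(Choice M N, Choice M' N') \<in> (cbeta \<C>)\<^sup>*"
proof -
  have "(Choice M N, Choice M' N) \<in> (cbeta \<C>)\<^sup>*"
    by (rule cbeta_rtrancl_map[where F = "\<lambda>C. CChoiceL C N" and f = "\<lambda>M. Choice M N", OF _ _ assms(2)])
       (auto simp: assms(1))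
  also have "(Choice M' N, Choice M' N') \<in> (cbeta \<C>)\<^sup>*"
    by (rule cbeta_rtrancl_map[where F = "CChoiceR M'" and f = "Choice M'", OF _ _ assms(3)])
       (auto simp: assms(1))
  finally show ?thesis .
qed

lemma cbeta_Lam:
  assumes "\<And>C. CLam C \<in> \<C>" and "(M, M') \<in> fbeta\<^sup>*"
  shows "(Lam M, Lam M') \<in> (cbeta \<C>)\<^sup>*"
  by (rule cbeta_rtrancl_map[where F = CLam and f = Lam, OF _ _ assms(2)]) (auto simp: assms(1))

lemma par_imp_fbeta: "par M N \<Longrightarrow> (M, N) \<in> fbeta\<^sup>*"
proof (induction rule: par.induct)
  case (par_beta M M' V V')
  then have "(App (Lam M) V, App (Lam M') V') \<in> fbeta\<^sup>*"
    by (intro cbeta_App cbeta_Lam) auto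
  also have "(App (Lam M') V', subst 0 V' M') \<in> fbeta"
    using cbetaI[of Hole] par_beta.hyps is_value_par by fastforce
  finally show ?case .
qed (auto intro: cbeta_App cbeta_Lam cbeta_Choice)

lemma ipar_imp_ibeta: "ipar M N \<Longrightarrow> (M, N) \<in> ibeta\<^sup>*"
  by (induction rule: ipar.induct) (auto intro: cbeta_App cbeta_Lam cbeta_Choice par_imp_fbeta)

section \<open>Reducing one element of a multi-distribution\<close>

lemma scale_add_mset [simp]: "scale q (add_mset (p, M) m) = add_mset (q * p, M) (scale q m)"
  by (simp add: scale_def)

lemma scale_empty [simp]: "scale q {#} = {#}"
  by (simp add: scale_def)

lemma scale_plus: "scale q (m + n) = scale q m + scale q n"
  by (simp add: scale_def)

lemma scale_scale: "scale q (scale p m) = scale (q * p) m"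
  by (induction m) auto

lemma scale_one [simp]: "scale 1 m = m"
  by (induction m) auto

text \<open>Exactly one element is reduced and the weights are unconstrained, so the relation is
  closed under sums and scaling without side conditions.\<close>

definition elift :: "(trm \<times> mdist) set \<Rightarrow> (mdist \<times> mdist) set" where
  "elift r = {(add_mset (p, M) k, scale p m + k) | p M m k. (M, m) \<in> r}"

lemma eliftI: "(M, m) \<in> r \<Longrightarrow> (add_mset (p, M) k, scale p m + k) \<in> elift r"
  by (auto simp: elift_def)

lemma elift_single: "(M, m) \<in> r \<Longrightarrow> ({#(1, M)#}, m) \<in> elift r"
  using eliftI[of M m r 1 "{#}"] by simp

lemma elift_mono: "r \<subseteq> s \<Longrightarrow> elift r \<subseteq> elift s"
  by (auto simp: elift_def)

lemma elift_Un: "elift (r \<union> s) = elift r \<union> elift s"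
  unfolding elift_def by blast

lemma elift_plus:
  assumes "(m, n) \<in> elift r"
  shows "(m + k, n + k) \<in> elift r"
proof -
  obtain p M m' l where "m = add_mset (p, M) l" "n = scale p m' + l" "(M, m') \<in> r"
    using assms by (auto simp: elift_def)
  then show ?thesis using eliftI[of M m' r p "l + k"] by (simp add: add.assoc)
qed

lemma elift_scale:
  assumes "(m, n) \<in> elift r"
  shows "(scale q m, scale q n) \<in> elift r"
proof -
  obtain p M m' l where "m = add_mset (p, M) l" "n = scale p m' + l" "(M, m') \<in> r"
    using assms by (auto simp: elift_def)
  then show ?thesis
    using eliftI[of M m' r "q * p" "scale q l"] by (simp add: scale_plus scale_scale)
qed

lemma elift_rtrancl_scale: "(m, n) \<in> (elift r)\<^sup>* \<Longrightarrow> (scale q m, scale q n) \<in> (elift r)\<^sup>*"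
  by (rule rtrancl_map[where f = "scale q", OF elift_scale])

lemma elift_rtrancl_plus:
  assumes "(m, n) \<in> (elift r)\<^sup>*" "(m', n') \<in> (elift r)\<^sup>*"
  shows "(m + m', n + n') \<in> (elift r)\<^sup>*"
proof -
  have "(m + m', n + m') \<in> (elift r)\<^sup>*"
    by (rule rtrancl_map[where f = "\<lambda>x. x + m'", OF elift_plus assms(1)])
  also have "(n + m', n + n') \<in> (elift r)\<^sup>*"
    using rtrancl_map[where f = "\<lambda>x. x + n", OF elift_plus assms(2)] by (simp add: add.commute)
  finally show ?thesis .
qed

lemma lifting_imp_elift: "(m, n) \<in> lifting r \<Longrightarrow> (m, n) \<in> (elift r)\<^sup>*"
proof (induction rule: lifting.induct)
  case (step M m)
  then show ?case using elift_single by blast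
next
  case (sum I p M m)
  \<comment> \<open>The elements are reduced one after another; \<open>J\<close> collects the
    indices already treated.\<close>
  have "({#(p i, M i). i \<in># mset_set J#}, (\<Sum>i\<in>J. scale (p i) (m i))) \<in> (elift r)\<^sup>*"
    if "finite J" "J \<subseteq> I" for J
    using that
  proof (induction J rule: finite_induct)
    case (insert j J)
    have "(scale (p j) {#(1, M j)#}, scale (p j) (m j)) \<in> (elift r)\<^sup>*"
      using insert.prems sum.IH by (intro elift_rtrancl_scale) auto
    from elift_rtrancl_plus[OF this insert.IH] insert.prems insert.hyps
    show ?case by simp
  qed simp
  with sum.hyps(1) show ?case by blast
qed auto

text \<open>The \<open>sum\<close> rule applies with \<open>step\<close> at the reduced element and
  \<open>refl\<close> at all others.\<close>

lemma elift_imp_lifting: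
  assumes "(m, n) \<in> elift r" "m \<in> mdists"
  shows "(m, n) \<in> lifting r"
proof -
  obtain p M m' k where *: "m = add_mset (p, M) k" "n = scale p m' + k" "(M, m') \<in> r"
    using assms(1) by (auto simp: elift_def)
  obtain xs where xs: "k = mset xs" by (metis ex_mset)
  let ?n = "length xs"
  \<comment> \<open>Indices below \<open>?n\<close> are the positions in \<open>xs\<close>, the
    elements left alone; \<open>?n\<close> is the reduced one. Positions keep equal elements
    apart.\<close>
  define P where "P i = (if i = ?n then p else fst (xs ! i))" for i
  define T where "T i = (if i = ?n then M else snd (xs ! i))" for i
  define D where "D i = (if i = ?n then m' else {#(1, T i)#})" for i
  have set: "mset_set {..<Suc ?n} = add_mset ?n (mset_set {..<?n})"
    by (simp add: lessThan_Suc)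
  have map: "{#(P i, T i). i \<in># mset_set {..<?n}#} = k"
  proof -
    have "{#(P i, T i). i \<in># mset_set {..<?n}#} = {#xs ! i. i \<in># mset_set {..<?n}#}"
      by (rule image_mset_cong) (auto simp: P_def T_def)
    also have "\<dots> = mset (map ((!) xs) [0..<?n])"
      by (simp add: atLeast0LessThan)
    finally show ?thesis by (simp add: map_nth xs)
  qed
  have m: "{#(P i, T i). i \<in># mset_set {..<Suc ?n}#} = m"
    using map by (simp add: set * P_def T_def)
  have "(\<Sum>i<?n. scale (P i) (D i)) = (\<Sum>i<?n. {#(P i, T i)#})"
    by (rule sum.cong) (auto simp: D_def)
  also have "\<dots> = k"
    using map by (simp add: sum_unfold_sum_mset sum_mset_singleton_mset
        flip: image_mset.compositionality)
  finally have n: "(\<Sum>i<Suc ?n. scale (P i) (D i)) = n"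
    by (simp add: * P_def D_def add.commute)
  have "({#(1, T i)#}, D i) \<in> lifting r" for i
    using *(3) by (auto simp: D_def T_def intro: lifting.refl lifting.step)
  then show ?thesis
    using lifting.sum[of "{..<Suc ?n}" P T D r] assms(2) unfolding m n by simp
qed

lemma elift_imp_lifting_rtrancl:
  assumes "(m, n) \<in> (elift r)\<^sup>*" "m \<in> mdists" "r \<subseteq> UNIV \<times> mdists"
  shows "(m, n) \<in> (lifting r)\<^sup>* \<and> n \<in> mdists"
  using assms(1)
proof (induction rule: rtrancl_induct)
  case (step n n')
  then have "(n, n') \<in> lifting r" using elift_imp_lifting by blast
  with step.IH lifting_mdists[OF assms(3)] show ?case
    by (auto intro: rtrancl_into_rtrancl)
qed (use assms(2) in auto)

lemma cbeta_imp_elift: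
  "(M, N) \<in> (cbeta \<C>)\<^sup>* \<Longrightarrow> ({#(p, M)#}, {#(p, N)#}) \<in> (elift (beta_v_in \<C>))\<^sup>*"
proof (rule rtrancl_map[where f = "\<lambda>M. {#(p, M)#}"])
  fix M N assume "(M, N) \<in> cbeta \<C>"
  then show "({#(p, M)#}, {#(p, N)#}) \<in> elift (beta_v_in \<C>)"
    using eliftI[of M "{#(1, N)#}" "beta_v_in \<C>" p "{#}"] by (simp add: beta_v_in_iff)
qed

section \<open>Factorization\<close>

text \<open>Elements are matched one to one with equal weights. As \<open>ipar\<close> is reflexive,
  any number of them may move in one step.\<close>

definition pointwise_ipar :: "mdist \<Rightarrow> mdist \<Rightarrow> bool" where
  "pointwise_ipar = rel_mset (rel_prod (=) ipar)"

lemma pointwise_ipar_refl: "pointwise_ipar m m"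
  unfolding pointwise_ipar_def by (rule multiset.rel_refl) (auto simp: ipar_refl rel_prod_sel)

lemma pointwise_ipar_add_mset:
  "pointwise_ipar m n \<Longrightarrow> ipar M N \<Longrightarrow> pointwise_ipar (add_mset (p, M) m) (add_mset (p, N) n)"
  unfolding pointwise_ipar_def by (rule rel_mset_Plus) auto

lemma pointwise_ipar_add_msetE:
  assumes "pointwise_ipar m (add_mset (p, N) n)"
  obtains M m' where "m = add_mset (p, M) m'" "ipar M N" "pointwise_ipar m' n"
proof -
  obtain m' x where "m = add_mset x m'" "rel_prod (=) ipar x (p, N)" "rel_mset (rel_prod (=) ipar) m' n"
    using msed_rel_invR[OF assms[unfolded pointwise_ipar_def]] by blast
  with that show thesis by (cases x) (auto simp: pointwise_ipar_def)
qed

lemma pointwise_ipar_induct [consumes 1, case_names empty add]: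
  assumes "pointwise_ipar m n" "Q {#} {#}"
    and "\<And>m n p M N. pointwise_ipar m n \<Longrightarrow> Q m n \<Longrightarrow> ipar M N \<Longrightarrow>
      Q (add_mset (p, M) m) (add_mset (p, N) n)"
  shows "Q m n"
  using assms(1)
proof (induction n arbitrary: m)
  case empty
  then have "m = {#}" by (auto simp: pointwise_ipar_def dest: rel_mset_size)
  with assms(2) show ?case by simp
next
  case (add x n)
  obtain p N where x: "x = (p, N)" by (cases x)
  from add.prems obtain M m' where "m = add_mset (p, M) m'" "ipar M N" "pointwise_ipar m' n"
    unfolding x by (rule pointwise_ipar_add_msetE)
  with add.IH show ?case by (simp add: x assms(3))
qed

lemma pointwise_ipar_plus:
  assumes "pointwise_ipar m n" "pointwise_ipar m' n'"
  shows "pointwise_ipar (m + m') (n + n')"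
  using assms(1) by (induction rule: pointwise_ipar_induct) (auto simp: assms(2) pointwise_ipar_add_mset)

lemma pointwise_ipar_scale: "pointwise_ipar m n \<Longrightarrow> pointwise_ipar (scale q m) (scale q n)"
  by (induction rule: pointwise_ipar_induct) (auto simp: pointwise_ipar_refl pointwise_ipar_add_mset)

lemma pointwise_ipar_imp_elift: "pointwise_ipar m n \<Longrightarrow> (m, n) \<in> (elift nonweak_beta_v)\<^sup>*"
proof (induction rule: pointwise_ipar_induct)
  case (add m n p M N)
  have "({#(p, M)#}, {#(p, N)#}) \<in> (elift nonweak_beta_v)\<^sup>*"
    unfolding nonweak_beta_v_def using add.hyps by (intro cbeta_imp_elift ipar_imp_ibeta)
  from elift_rtrancl_plus[OF this add.IH] show ?case by simp
qed simp

section \<open>Postponement on multi-distributions\<close>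

abbreviation weak_step :: "(trm \<times> mdist) set" where
  "weak_step \<equiv> weak_beta_v \<union> oplus"

lemma weak_beta_v_rtrancl_elift:
  assumes "(M, N) \<in> wbeta\<^sup>*"
  shows "({#(p, M)#}, {#(p, N)#}) \<in> (elift weak_step)\<^sup>*"
proof -
  have "({#(p, M)#}, {#(p, N)#}) \<in> (elift weak_beta_v)\<^sup>*"
    unfolding weak_beta_v_def by (rule cbeta_imp_elift[OF assms])
  also have "(elift weak_beta_v)\<^sup>* \<subseteq> (elift weak_step)\<^sup>*"
    by (intro rtrancl_mono elift_mono) simp
  finally show ?thesis .
qed

lemma ipar_weak_step_postpone:
  assumes "ipar M P" "(P, n) \<in> weak_step"
  shows "\<exists>m. ({#(1, M)#}, m) \<in> (elift weak_step)\<^sup>* \<and> pointwise_ipar m n"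
  using assms(2)
proof
  assume "(P, n) \<in> weak_beta_v"
  then obtain N where n: "n = {#(1, N)#}" and "(P, N) \<in> wbeta"
    by (auto simp: weak_beta_v_def beta_v_in_iff)
  with assms(1) obtain Q where Q: "(M, Q) \<in> wbeta\<^sup>*" "ipar Q N"
    using ipar_wbeta_postpone by blast
  have "pointwise_ipar {#(1, Q)#} n"
    unfolding n by (intro pointwise_ipar_add_mset pointwise_ipar_refl Q(2))
  with weak_beta_v_rtrancl_elift[OF Q(1)] show ?thesis by blast
next
  assume "(P, n) \<in> oplus"
  then obtain S A B where S: "weak S" "P = plug S (Choice A B)"
    and n: "n = {#(1/2, plug S A), (1/2, plug S B)#}"
    by (auto simp: oplus_def)
  obtain T A\<^sub>0 B\<^sub>0 A\<^sub>1 B\<^sub>1 where T: "weak T" "M = plug T (Choice A\<^sub>0 B\<^sub>0)"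
    and A: "(plug T A\<^sub>0, A\<^sub>1) \<in> wbeta\<^sup>*" "ipar A\<^sub>1 (plug S A)"
    and B: "(plug T B\<^sub>0, B\<^sub>1) \<in> wbeta\<^sup>*" "ipar B\<^sub>1 (plug S B)"
    using ipar_oplus_postpone assms(1) S by blast
  have "(M, {#(1/2, plug T A\<^sub>0), (1/2, plug T B\<^sub>0)#}) \<in> weak_step"
    using T by (auto simp: oplus_def)
  from elift_single[OF this]
  have "({#(1, M)#}, {#(1/2, plug T A\<^sub>0), (1/2, plug T B\<^sub>0)#}) \<in> elift weak_step" .
  also have "({#(1/2, plug T A\<^sub>0), (1/2, plug T B\<^sub>0)#}, {#(1/2, A\<^sub>1), (1/2, B\<^sub>1)#})
      \<in> (elift weak_step)\<^sup>*"
    using elift_rtrancl_plus[OF weak_beta_v_rtrancl_elift[OF A(1), of "1/2"]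
        weak_beta_v_rtrancl_elift[OF B(1), of "1/2"]]
    by (simp add: add_mset_commute)
  finally have "({#(1, M)#}, {#(1/2, A\<^sub>1), (1/2, B\<^sub>1)#}) \<in> (elift weak_step)\<^sup>*" .
  moreover have "pointwise_ipar {#(1/2, A\<^sub>1), (1/2, B\<^sub>1)#} n"
    unfolding n by (intro pointwise_ipar_add_mset pointwise_ipar_refl A(2) B(2))
  ultimately show ?thesis by blast
qed

lemma pointwise_ipar_elift_postpone:
  assumes "pointwise_ipar m m'" "(m', n) \<in> elift weak_step"
  shows "\<exists>k. (m, k) \<in> (elift weak_step)\<^sup>* \<and> pointwise_ipar k n"
proof -
  obtain p P k n' where *: "m' = add_mset (p, P) k" "n = scale p n' + k" "(P, n') \<in> weak_step"
    using assms(2) by (auto simp: elift_def)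
  obtain M k' where k': "m = add_mset (p, M) k'" "ipar M P" "pointwise_ipar k' k"
    using assms(1) unfolding *(1) by (elim pointwise_ipar_add_msetE)
  obtain l where l: "({#(1, M)#}, l) \<in> (elift weak_step)\<^sup>*" "pointwise_ipar l n'"
    using ipar_weak_step_postpone[OF k'(2) *(3)] by blast
  \<comment> \<open>The simulation was found at weight 1; it is scaled to \<open>p\<close> and run
    beside the untouched rest \<open>k'\<close>.\<close>
  have "(m, scale p l + k') \<in> (elift weak_step)\<^sup>*"
    using elift_rtrancl_plus[OF elift_rtrancl_scale[OF l(1), of p] rtrancl_refl[of k']]
    by (simp add: k'(1))
  moreover have "pointwise_ipar (scale p l + k') n"
    unfolding *(2) by (intro pointwise_ipar_plus pointwise_ipar_scale l(2) k'(3))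
  ultimately show ?thesis by blast
qed

lemma pointwise_ipar_elift_rtrancl_postpone:
  assumes "(m', n) \<in> (elift weak_step)\<^sup>*" "pointwise_ipar m m'"
  shows "\<exists>k. (m, k) \<in> (elift weak_step)\<^sup>* \<and> pointwise_ipar k n"
  using assms
proof (induction rule: rtrancl_induct)
  case (step y z)
  then show ?case by (meson pointwise_ipar_elift_postpone rtrancl_trans)
qed blast

text \<open>Crossing a pointwise step may multiply the weak steps, but leaves exactly one pointwise
  step. Induction on the chain of pointwise steps therefore works.\<close>

lemma pointwise_ipar_rtranclp_postpone:
  assumes "pointwise_ipar\<^sup>*\<^sup>* m m'" "(m', n) \<in> elift weak_step"
  shows "\<exists>k. (m, k) \<in> (elift weak_step)\<^sup>* \<and> pointwise_ipar\<^sup>*\<^sup>* k n"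
  using assms(1)
proof (induction rule: converse_rtranclp_induct)
  case base
  then show ?case using assms(2) by blast
next
  case (step x y)
  then show ?case
    by (meson pointwise_ipar_elift_rtrancl_postpone converse_rtranclp_into_rtranclp)
qed

lemma beta_v_split: "beta_v = weak_beta_v \<union> nonweak_beta_v"
  unfolding beta_v_def weak_beta_v_def nonweak_beta_v_def beta_v_in_def by blast

lemma elift_nonweak_imp_pointwise_ipar:
  assumes "(m, n) \<in> elift nonweak_beta_v"
  shows "pointwise_ipar m n"
proof -
  obtain p M N k where "m = add_mset (p, M) k" "n = add_mset (p, N) k" "(M, N) \<in> ibeta"
    using assms by (auto simp: elift_def nonweak_beta_v_def beta_v_in_iff)
  then show ?thesis
    by (simp add: pointwise_ipar_add_mset pointwise_ipar_refl ibeta_imp_ipar)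
qed

lemma elift_factorization:
  assumes "(m, n) \<in> (elift (beta_v \<union> oplus))\<^sup>*"
  shows "\<exists>k. (m, k) \<in> (elift weak_step)\<^sup>* \<and> pointwise_ipar\<^sup>*\<^sup>* k n"
  using assms
proof (induction rule: rtrancl_induct)
  case (step n n')
  then obtain k where k: "(m, k) \<in> (elift weak_step)\<^sup>*" "pointwise_ipar\<^sup>*\<^sup>* k n" by blast
  \<comment> \<open>A weak step is moved to the front through the internal tail; a non-weak one just
    extends that tail.\<close>
  have "(n, n') \<in> elift weak_step \<or> (n, n') \<in> elift nonweak_beta_v"
    using step.hyps(2) by (auto simp: elift_Un beta_v_split)
  then show ?case
  proof
    assume "(n, n') \<in> elift weak_step"
    with k show ?thesis by (meson pointwise_ipar_rtranclp_postpone rtrancl_trans)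
  next
    assume "(n, n') \<in> elift nonweak_beta_v"
    with k show ?thesis
      by (meson elift_nonweak_imp_pointwise_ipar rtranclp.rtrancl_into_rtrancl)
  qed
qed blast

lemma elift_weak_imp_weak_red:
  assumes "(m, n) \<in> (elift weak_step)\<^sup>*" "m \<in> mdists"
  shows "(m, n) \<in> weak_red\<^sup>* \<and> n \<in> mdists"
  using assms(1)
proof (induction rule: rtrancl_induct)
  case (step n n')
  have "(n, n') \<in> elift weak_beta_v \<or> (n, n') \<in> elift oplus"
    using step.hyps(2) by (simp add: elift_Un)
  then have n': "(n, n') \<in> weak_red"
    using step.IH elift_imp_lifting by (auto simp: weak_red_def)
  then have "n' \<in> mdists"
    using lifting_mdists[OF step_mdists(1)] lifting_mdists[OF step_mdists(2)]
    by (auto simp: weak_red_def weak_beta_v_def)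
  with n' step.IH show ?case by (auto intro: rtrancl_into_rtrancl)
qed (use assms(2) in auto)

theorem theoremB2:
  "(lifting beta_v \<union> lifting oplus)\<^sup>* \<subseteq> weak_red\<^sup>* O nonweak_red\<^sup>*"
proof
  fix x assume x: "x \<in> (lifting beta_v \<union> lifting oplus)\<^sup>*"
  obtain m n where mn: "x = (m, n)" by (cases x)
  show "x \<in> weak_red\<^sup>* O nonweak_red\<^sup>*"
  proof (cases "m \<in> mdists")
    case False
    \<comment> \<open>Lifted steps start only from multi-distributions, so here the reduction is
      empty. Since \<open>elift\<close> ignores the weights, this case must be split off before
      passing to it.\<close>
    then have "(m, k) \<notin> lifting beta_v \<union> lifting oplus" for k
      using lifting_mdists[OF step_mdists(1)[of UNIV]] lifting_mdists[OF step_mdists(2)]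
      by (auto simp: beta_v_def)
    with x have "m = n"
      unfolding mn by (metis converse_rtranclE)
    then show ?thesis by (auto simp: mn)
  next
    case True
    have "lifting r \<subseteq> (elift (beta_v \<union> oplus))\<^sup>*" if "r \<subseteq> beta_v \<union> oplus" for r
      using lifting_imp_elift rtrancl_mono[OF elift_mono[OF that]] by auto
    then have "lifting beta_v \<union> lifting oplus \<subseteq> (elift (beta_v \<union> oplus))\<^sup>*"
      by simp
    from rtrancl_subset_rtrancl[OF this] have "(m, n) \<in> (elift (beta_v \<union> oplus))\<^sup>*"
      using x unfolding mn by blast
    then obtain k where k: "(m, k) \<in> (elift weak_step)\<^sup>*" "pointwise_ipar\<^sup>*\<^sup>* k n"
      using elift_factorization by blast
    have "(m, k) \<in> weak_red\<^sup>*" "k \<in> mdists"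
      using elift_weak_imp_weak_red[OF k(1) True] by auto
    \<comment> \<open>Each pointwise step unfolds into single non-weak steps, which are lifted steps
      because \<open>k\<close> is a multi-distribution.\<close>
    moreover have "(k, n) \<in> (elift nonweak_beta_v)\<^sup>*"
      using k(2) by (induction rule: rtranclp_induct) (auto dest: pointwise_ipar_imp_elift)
    ultimately show ?thesis
      using elift_imp_lifting_rtrancl[of k n nonweak_beta_v] step_mdists(1)
      by (auto simp: mn nonweak_red_def nonweak_beta_v_def)
  qed
qed

end
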